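(* Let $p$ be a prime and let $G$ be a finite $p$-group. Then $G$ is autonilpotent if and only if $\mathrm{Aut}\,G$ is a $p$-group.
   Context: All groups are finite. $\mathrm{Aut}\,G$ is the group of all automorphisms of $G$. The trivial group counts as a $p$-group. For $x\in G$ and $\alpha\in\mathrm{Aut}\,G$, $x^\alpha$ denotes the image of $x$ under $\alpha$, $[x,\alpha]=x^{-1}x^\alpha$, and inductively $[x,\alpha_1,\dots,\alpha_n]=[[x,\alpha_1,\dots,\alpha_{n-1}],\alpha_n]$. For a natural number $n$ let $L_n(G)=\{x\in G \mid [x,\alpha_1,\dots,\alpha_n]=1 \text{ for all } \alpha_1,\dots,\alpha_n\in\mathrm{Aut}\,G\}$. The group $G$ is called autonilpotent if $G=L_n(G)$ for some natural number $n$. *)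

theory Defs
  imports "HOL-Algebra.Bij" "HOL-Algebra.Coset" "HOL-Computational_Algebra.Primes"
begin

text \<open>
  The automorphism group is the library's \<^term>\<open>AutoGroup G\<close>, with carrier \<^term>\<open>auto G\<close>: the
  bijective endomorphisms that are extensional, so that each automorphism is counted once.
  Its product is composition of functions written on the left; the exponent notation
  $x^\alpha$ corresponds to the opposite product, which has the same order.
\<close>

text \<open>
  The order is 0 when the carrier is infinite, so for prime \<open>p\<close> the condition on the order
  forces the group to be finite. The exponent 0 admits the trivial group.
\<close>
definition finite_p_group :: "nat \<Rightarrow> ('a, 'b) monoid_scheme \<Rightarrow> bool"
  where "finite_p_group p G \<longleftrightarrow> group G \<and> (\<exists>k. order G = p ^ k)"

definition autocomm :: "('a, 'b) monoid_scheme \<Rightarrow> 'a \<Rightarrow> ('a \<Rightarrow> 'a) \<Rightarrow> 'a"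
  where "autocomm G x \<alpha> = inv\<^bsub>G\<^esub> x \<otimes>\<^bsub>G\<^esub> \<alpha> x"

text \<open>\<open>iter_autocomm G x [\<alpha>\<^sub>1, \<dots>, \<alpha>\<^sub>n]\<close> is the left-normed $[x,\alpha_1,\dots,\alpha_n]$.\<close>
definition iter_autocomm :: "('a, 'b) monoid_scheme \<Rightarrow> 'a \<Rightarrow> ('a \<Rightarrow> 'a) list \<Rightarrow> 'a"
  where "iter_autocomm G x \<alpha>s = foldl (autocomm G) x \<alpha>s"

definition autocenter :: "nat \<Rightarrow> ('a, 'b) monoid_scheme \<Rightarrow> 'a set"
  where "autocenter n G =
    {x \<in> carrier G. \<forall>\<alpha>s. set \<alpha>s \<subseteq> auto G \<and> length \<alpha>s = n \<longrightarrow> iter_autocomm G x \<alpha>s = \<one>\<^bsub>G\<^esub>}"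

text \<open>
  For \<open>n = 0\<close> the only list is empty and \<open>autocenter 0 G\<close> is trivial, so allowing \<open>n = 0\<close> adds
  only the trivial group, for which \<open>n = 1\<close> works as well.
\<close>
definition autonilpotent :: "('a, 'b) monoid_scheme \<Rightarrow> bool"
  where "autonilpotent G \<longleftrightarrow> (\<exists>n. carrier G = autocenter n G)"

end

theory Submission
  imports Defs "HOL-Algebra.Group_Action" "HOL-Algebra.Sylow" "HOL-Algebra.Multiplicative_Group"
begin

text \<open>
  Write \<open>A\<close> for the automorphism group of \<open>G\<close> and \<open>L\<^sub>n\<close> for \<^term>\<open>autocenter n G\<close>. The sets \<open>L\<^sub>n\<close>
  form the upper central series of the action of \<open>A\<close> on \<open>G\<close>: \<open>L\<^sub>0\<close> is trivial and \<open>L\<^sub>n\<^sub>+\<^sub>1\<close>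
  consists of the \<open>x\<close> with \<open>[x,\<alpha>] \<in> L\<^sub>n\<close> for all \<open>\<alpha>\<close> (\<open>autocenter_Suc\<close>). Each \<open>L\<^sub>n\<close> is a
  characteristic subgroup, and hence normal because \<open>A\<close> contains the conjugations.

  Suppose that \<open>A\<close> is a \<open>p\<close>-group. If \<open>L\<^sub>n\<close> is proper, its index in \<open>G\<close> is divisible by \<open>p\<close>,
  and \<open>A\<close> permutes its cosets. The number of fixed cosets is then divisible by \<open>p\<close>
  (\<open>card_fixed_points_mod_prime\<close>). As the coset \<open>L\<^sub>n\<close> is fixed, so is another one, and a
  representative of it lies in \<open>L\<^sub>n\<^sub>+\<^sub>1\<close> but not in \<open>L\<^sub>n\<close> (\<open>exists_auto_fixed_coset\<close>). A series that
  grows strictly as long as it is proper reaches the finite group \<open>G\<close>.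

  Conversely, suppose that \<open>G = L\<^sub>n\<close>. If a prime \<open>q\<close> divides the order of \<open>A\<close> but not that of
  \<open>G\<close>, then by Cauchy's theorem some \<open>\<alpha> \<in> A\<close> has order \<open>q\<close>. By induction on \<open>n\<close> this \<open>\<alpha>\<close>
  fixes \<open>y = [x,\<alpha>]\<close>, so \<open>\<alpha>\<^sup>q\<close> sends \<open>x\<close> to \<open>x y\<^sup>q\<close>. Hence \<open>y\<^sup>q = 1\<close>, so \<open>y = 1\<close>, and \<open>\<alpha>\<close>
  fixes \<open>x\<close> (\<open>coprime_auto_fixes_autocenter\<close>). Thus \<open>\<alpha>\<close> is trivial, a contradiction. This
  direction works for every finite \<open>G\<close>: each prime divisor of the order of \<open>A\<close> divides the
  order of \<open>G\<close> (\<open>prime_dvd_order_AutoGroup\<close>).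
\<close>

section \<open>Automorphisms\<close>

context group
begin

lemma carrier_AutoGroup [simp]: "carrier (AutoGroup G) = auto G"
  by (simp add: AutoGroup_def)

lemma one_AutoGroup: "\<one>\<^bsub>AutoGroup G\<^esub> = (\<lambda>x\<in>carrier G. x)"
  by (simp add: AutoGroup_def BijGroup_def)

lemma mult_AutoGroup_apply:
  assumes "\<alpha> \<in> auto G" "\<beta> \<in> auto G" "x \<in> carrier G"
  shows "(\<alpha> \<otimes>\<^bsub>AutoGroup G\<^esub> \<beta>) x = \<alpha> (\<beta> x)"
  using assms by (simp add: AutoGroup_def BijGroup_def auto_def compose_def)

lemma auto_closed [simp]:
  assumes "\<alpha> \<in> auto G" "x \<in> carrier G"
  shows "\<alpha> x \<in> carrier G"
  using assms by (auto simp: auto_def hom_def)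

lemma auto_group_hom: "\<alpha> \<in> auto G \<Longrightarrow> group_hom G G \<alpha>"
  by (simp add: auto_def group_hom_def group_hom_axioms_def is_group)

lemma auto_mult:
  assumes "\<alpha> \<in> auto G" "x \<in> carrier G" "y \<in> carrier G"
  shows "\<alpha> (x \<otimes> y) = \<alpha> x \<otimes> \<alpha> y"
  using group_hom.hom_mult[OF auto_group_hom] assms by blast

lemma auto_inv:
  assumes "\<alpha> \<in> auto G" "x \<in> carrier G"
  shows "\<alpha> (inv x) = inv (\<alpha> x)"
  using group_hom.hom_inv[OF auto_group_hom] assms by blast

lemma auto_nat_pow:
  assumes "\<alpha> \<in> auto G" "x \<in> carrier G"
  shows "\<alpha> (x [^] (n::nat)) = \<alpha> x [^] n"
  using group_hom.hom_nat_pow[OF auto_group_hom] assms by blast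

lemma auto_one: "\<alpha> \<in> auto G \<Longrightarrow> \<alpha> \<one> = \<one>"
  using group_hom.hom_one[OF auto_group_hom] by blast

text \<open>
  Conjugating \<open>\<alpha>\<close> by \<open>\<beta>\<close> yields \<open>\<gamma>\<close> with \<open>\<beta> [x,\<gamma>] = [\<beta> x,\<alpha>]\<close>. As \<open>\<gamma>\<close> is again an
  automorphism, this makes the autocentral series invariant.
\<close>
lemma auto_conjugate_exists:
  assumes "\<alpha> \<in> auto G" "\<beta> \<in> auto G"
  obtains \<gamma> where "\<gamma> \<in> auto G" "\<And>x. x \<in> carrier G \<Longrightarrow> \<beta> (\<gamma> x) = \<alpha> (\<beta> x)"
proof
  interpret A: group "AutoGroup G" by (rule AutoGroup)
  let ?\<gamma> = "inv\<^bsub>AutoGroup G\<^esub> \<beta> \<otimes>\<^bsub>AutoGroup G\<^esub> (\<alpha> \<otimes>\<^bsub>AutoGroup G\<^esub> \<beta>)"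
  show in_auto: "?\<gamma> \<in> auto G"
    using A.m_closed A.inv_closed assms by simp
  have eq: "\<beta> \<otimes>\<^bsub>AutoGroup G\<^esub> ?\<gamma> = \<alpha> \<otimes>\<^bsub>AutoGroup G\<^esub> \<beta>"
    using A.m_closed A.inv_closed A.r_inv A.l_one assms by (simp add: A.m_assoc[symmetric])
  fix x assume "x \<in> carrier G"
  then show "\<beta> (?\<gamma> x) = \<alpha> (\<beta> x)"
    using mult_AutoGroup_apply[OF assms(2) in_auto, of x] mult_AutoGroup_apply[OF assms, of x] eq
    by simp
qed

lemma conjugation_in_auto:
  assumes "g \<in> carrier G"
  shows "(\<lambda>x\<in>carrier G. g \<otimes> x \<otimes> inv g) \<in> auto G"
proof -
  have "g \<otimes> (x \<otimes> y) \<otimes> inv g = g \<otimes> x \<otimes> inv g \<otimes> (g \<otimes> y \<otimes> inv g)"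
    if "x \<in> carrier G" "y \<in> carrier G" for x y
    using assms that by (simp add: m_assoc inv_solve_left)
  then have "(\<lambda>x\<in>carrier G. g \<otimes> x \<otimes> inv g) \<in> hom G G"
    using assms by (auto simp: hom_def)
  then show ?thesis
    using conjugation_is_bij[OF assms] by (simp add: auto_def Bij_def)
qed

lemma finite_auto:
  assumes "finite (carrier G)"
  shows "finite (auto G)"
proof (rule finite_subset)
  show "auto G \<subseteq> carrier G \<rightarrow>\<^sub>E carrier G"
  proof
    fix \<alpha> assume \<alpha>: "\<alpha> \<in> auto G"
    then have "\<alpha> \<in> extensional (carrier G)"
      by (simp add: auto_def Bij_def)
    then show "\<alpha> \<in> carrier G \<rightarrow>\<^sub>E carrier G"
      using \<alpha> by (simp add: PiE_def)
  qed
  show "finite (carrier G \<rightarrow>\<^sub>E carrier G)"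
    using assms by (simp add: finite_PiE)
qed

lemma characteristic_subgroup_normal:
  assumes "subgroup N G" "\<And>\<alpha> x. \<alpha> \<in> auto G \<Longrightarrow> x \<in> N \<Longrightarrow> \<alpha> x \<in> N"
  shows "N \<lhd> G"
  unfolding normal_inv_iff
proof (intro conjI ballI)
  fix g x assume "g \<in> carrier G" "x \<in> N"
  moreover from this have "x \<in> carrier G"
    using subgroup.mem_carrier[OF assms(1)] by blast
  ultimately show "g \<otimes> x \<otimes> inv g \<in> N"
    using assms(2)[OF conjugation_in_auto, of g x] by simp
qed fact

section \<open>The autocentral series\<close>

lemma autocomm_closed [simp]:
  assumes "x \<in> carrier G" "\<alpha> \<in> auto G"
  shows "autocomm G x \<alpha> \<in> carrier G"
  using assms by (simp add: autocomm_def)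

text \<open>
  The next two identities write commutators of products and inverses as products of conjugates
  of commutators, so the \<open>x\<close> whose commutators all lie in a given normal subgroup form a
  subgroup.
\<close>
lemma autocomm_mult:
  assumes "x \<in> carrier G" "y \<in> carrier G" "\<alpha> \<in> auto G"
  shows "autocomm G (x \<otimes> y) \<alpha> = inv y \<otimes> autocomm G x \<alpha> \<otimes> y \<otimes> autocomm G y \<alpha>"
proof -
  have "y \<otimes> (inv y \<otimes> \<alpha> y) = \<alpha> y"
    using assms by (simp add: m_assoc[symmetric])
  then show ?thesis
    using assms by (simp add: autocomm_def auto_mult inv_mult_group m_assoc)
qed

lemma autocomm_inv:
  assumes "x \<in> carrier G" "\<alpha> \<in> auto G"
  shows "autocomm G (inv x) \<alpha> = x \<otimes> inv (autocomm G x \<alpha>) \<otimes> inv x"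
  using assms by (simp add: autocomm_def auto_inv inv_mult_group m_assoc)

lemma autocenter_0: "autocenter 0 G = {\<one>}"
  by (auto simp: autocenter_def iter_autocomm_def)

text \<open>
  A left-normed commutator of length \<open>n + 1\<close> starting at \<open>x\<close> is one of length \<open>n\<close> starting at
  \<open>[x,\<alpha>]\<close>.
\<close>
lemma autocenter_Suc:
  "autocenter (Suc n) G = {x \<in> carrier G. \<forall>\<alpha>\<in>auto G. autocomm G x \<alpha> \<in> autocenter n G}"
    (is "?L = ?R")
proof (intro equalityI subsetI)
  fix x assume x: "x \<in> ?L"
  have "iter_autocomm G (autocomm G x \<alpha>) \<alpha>s = \<one>"
    if "\<alpha> \<in> auto G" "set \<alpha>s \<subseteq> auto G" "length \<alpha>s = n" for \<alpha> \<alpha>s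
  proof -
    have "set (\<alpha> # \<alpha>s) \<subseteq> auto G \<and> length (\<alpha> # \<alpha>s) = Suc n"
      using that by simp
    then have "iter_autocomm G x (\<alpha> # \<alpha>s) = \<one>"
      using x unfolding autocenter_def by blast
    then show ?thesis
      by (simp add: iter_autocomm_def)
  qed
  then show "x \<in> ?R"
    using x by (auto simp: autocenter_def)
next
  fix x assume "x \<in> ?R"
  then show "x \<in> ?L"
    by (auto simp: autocenter_def iter_autocomm_def length_Suc_conv)
qed

text \<open>
  The two properties go through one induction: \<open>L\<^sub>n\<^sub>+\<^sub>1\<close> is closed under the group operations
  because \<open>L\<^sub>n\<close> is normal, and \<open>L\<^sub>n\<close> is normal because it is a characteristic subgroup.
\<close>
lemma autocenter_characteristic_subgroup:
  "subgroup (autocenter n G) G \<and> (\<forall>\<beta>\<in>auto G. \<forall>x\<in>autocenter n G. \<beta> x \<in> autocenter n G)"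
proof (induction n)
  case 0
  then show ?case
    by (simp add: autocenter_0 triv_subgroup auto_one)
next
  case (Suc n)
  then have sub: "subgroup (autocenter n G) G"
    and invariant: "\<And>\<beta> x. \<beta> \<in> auto G \<Longrightarrow> x \<in> autocenter n G \<Longrightarrow> \<beta> x \<in> autocenter n G"
    by auto
  interpret N: normal "autocenter n G" G
    by (rule characteristic_subgroup_normal[OF sub], rule invariant)
  have "subgroup (autocenter (Suc n) G) G"
  proof (rule subgroupI)
    have "\<one> \<in> autocenter (Suc n) G"
      by (simp add: autocenter_Suc autocomm_def auto_one)
    then show "autocenter (Suc n) G \<noteq> {}" by blast
  next
    fix x assume "x \<in> autocenter (Suc n) G"
    then show "inv x \<in> autocenter (Suc n) G"
      by (simp add: autocenter_Suc autocomm_inv N.inv_op_closed2)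
  next
    fix x y assume "x \<in> autocenter (Suc n) G" "y \<in> autocenter (Suc n) G"
    then show "x \<otimes> y \<in> autocenter (Suc n) G"
      by (simp add: autocenter_Suc autocomm_mult N.inv_op_closed1)
  qed (simp add: autocenter_Suc)
  moreover have "\<beta> x \<in> autocenter (Suc n) G"
    if \<beta>: "\<beta> \<in> auto G" and x: "x \<in> autocenter (Suc n) G" for \<beta> x
  proof -
    have xG: "x \<in> carrier G" using x by (simp add: autocenter_Suc)
    have "autocomm G (\<beta> x) \<alpha> \<in> autocenter n G" if \<alpha>: "\<alpha> \<in> auto G" for \<alpha>
    proof -
      obtain \<gamma> where \<gamma>: "\<gamma> \<in> auto G" "\<And>x. x \<in> carrier G \<Longrightarrow> \<beta> (\<gamma> x) = \<alpha> (\<beta> x)"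
        using auto_conjugate_exists[OF \<alpha> \<beta>] by blast
      then have "autocomm G (\<beta> x) \<alpha> = \<beta> (autocomm G x \<gamma>)"
        using xG \<beta> by (simp add: autocomm_def auto_mult auto_inv)
      then show ?thesis
        using invariant \<beta> \<gamma> x by (simp add: autocenter_Suc)
    qed
    then show ?thesis
      using xG \<beta> by (simp add: autocenter_Suc)
  qed
  ultimately show ?case by blast
qed

lemma autocenter_mono_Suc: "autocenter n G \<subseteq> autocenter (Suc n) G"
proof
  fix x assume x: "x \<in> autocenter n G"
  have sub: "subgroup (autocenter n G) G"
    using autocenter_characteristic_subgroup by blast
  have "autocomm G x \<alpha> \<in> autocenter n G" if "\<alpha> \<in> auto G" for \<alpha>
    using x that autocenter_characteristic_subgroup[of n] sub
    by (simp add: autocomm_def subgroup.m_inv_closed subgroup.m_closed)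
  then show "x \<in> autocenter (Suc n) G"
    using x subgroup.mem_carrier[OF sub] by (simp add: autocenter_Suc)
qed

section \<open>Automorphisms of coprime order\<close>

lemma auto_pow_apply:
  assumes "\<alpha> \<in> auto G" "x \<in> carrier G" "y \<in> carrier G" "\<alpha> x = x \<otimes> y" "\<alpha> y = y"
  shows "(\<alpha> [^]\<^bsub>AutoGroup G\<^esub> (n::nat)) x = x \<otimes> y [^] n"
proof (induction n)
  case 0
  then show ?case using assms by (simp add: one_AutoGroup)
next
  case (Suc n)
  interpret A: group "AutoGroup G" by (rule AutoGroup)
  have "\<alpha> [^]\<^bsub>AutoGroup G\<^esub> Suc n = \<alpha> \<otimes>\<^bsub>AutoGroup G\<^esub> \<alpha> [^]\<^bsub>AutoGroup G\<^esub> n"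
    using A.nat_pow_Suc2 assms(1) by simp
  moreover have "\<alpha> [^]\<^bsub>AutoGroup G\<^esub> n \<in> auto G"
    using A.nat_pow_closed assms(1) by simp
  ultimately have "(\<alpha> [^]\<^bsub>AutoGroup G\<^esub> Suc n) x = \<alpha> (x \<otimes> y [^] n)"
    using mult_AutoGroup_apply assms Suc by simp
  also have "\<dots> = x \<otimes> (y \<otimes> y [^] n)"
    using assms by (simp add: auto_mult auto_nat_pow m_assoc)
  finally show ?case
    using assms by (metis nat_pow_Suc2)
qed

lemma eq_one_if_coprime_pow:
  assumes "y \<in> carrier G" "y [^] m = \<one>" "coprime m (order G)"
  shows "y = \<one>"
proof -
  have "ord y dvd m" "ord y dvd order G"
    using assms pow_eq_id ord_dvd_group_order by auto
  then have "ord y = 1"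
    using assms(3) by (metis coprime_common_divisor_nat)
  then show ?thesis
    using assms(1) ord_eq_1 by blast
qed

text \<open>
  An automorphism whose order is coprime to that of \<open>G\<close> cannot stabilise the autocentral
  series unless it acts trivially on it: by induction \<open>y = [x,\<alpha>]\<close> is fixed, so applying \<open>\<alpha>\<close>
  repeatedly to \<open>x\<close> multiplies it by \<open>y\<close> each time, and after \<open>m\<close> steps \<open>y\<^sup>m\<close> must be trivial.
\<close>
lemma coprime_auto_fixes_autocenter:
  assumes \<alpha>: "\<alpha> \<in> auto G" "\<alpha> [^]\<^bsub>AutoGroup G\<^esub> m = \<one>\<^bsub>AutoGroup G\<^esub>"
    and m: "coprime m (order G)"
  shows "x \<in> autocenter n G \<Longrightarrow> \<alpha> x = x"
proof (induction n arbitrary: x)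
  case 0
  then show ?case using \<alpha> by (simp add: autocenter_0 auto_one)
next
  case (Suc n)
  define y where "y = autocomm G x \<alpha>"
  have x: "x \<in> carrier G" and y: "y \<in> carrier G" and "\<alpha> y = y"
    using Suc \<alpha>(1) by (auto simp: y_def autocenter_Suc)
  have \<alpha>x: "\<alpha> x = x \<otimes> y"
    using x \<alpha>(1) by (simp add: y_def autocomm_def m_assoc[symmetric])
  have "x \<otimes> y [^] m = x"
    using auto_pow_apply[OF \<alpha>(1) x y \<alpha>x \<open>\<alpha> y = y\<close>, of m] \<alpha>(2) x by (simp add: one_AutoGroup)
  then have "y [^] m = \<one>"
    using x y by simp
  then have "y = \<one>"
    using eq_one_if_coprime_pow y m by blast
  then show ?case
    using \<alpha>x x by simp
qed

text \<open>
  Cauchy's theorem is the case of exponent 1 of Sylow's first theorem, which yields a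
  subgroup of order \<open>q\<close>.
\<close>
lemma cauchy:
  assumes "finite (carrier G)" "prime q" "q dvd order G"
  obtains x where "x \<in> carrier G" "x \<noteq> \<one>" "x [^] q = \<one>"
proof -
  obtain m where "order G = q ^ 1 * m"
    using assms(3) by auto
  then obtain H where H: "subgroup H G" "card H = q"
    using sylow_thm[OF assms(2) is_group _ assms(1)] by fastforce
  interpret H: group "G\<lparr>carrier := H\<rparr>"
    using H(1) is_group by (rule subgroup.subgroup_is_group)
  have "card H > 1"
    using H(2) assms(2) prime_gt_1_nat by simp
  then have "H \<noteq> {\<one>}" by auto
  then obtain x where x: "x \<in> H" "x \<noteq> \<one>"
    using subgroup.one_closed[OF H(1)] by blast
  have "x [^]\<^bsub>G\<lparr>carrier := H\<rparr>\<^esub> q = \<one>"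
    using H.pow_order_eq_1[of x] x H(2) by (simp add: order_def)
  then have "x [^] q = \<one>"
    by (simp add: nat_pow_consistent[where H = H])
  then show ?thesis
    using that x subgroup.mem_carrier[OF H(1)] by blast
qed

lemma prime_dvd_order_AutoGroup:
  assumes fin: "finite (carrier G)" and "autonilpotent G"
    and q: "prime q" "q dvd order (AutoGroup G)"
  shows "q dvd order G"
proof (rule ccontr)
  assume "\<not> q dvd order G"
  then have cop: "coprime q (order G)"
    using q(1) by (simp add: prime_imp_coprime)
  obtain \<alpha> where \<alpha>: "\<alpha> \<in> auto G" "\<alpha> \<noteq> \<one>\<^bsub>AutoGroup G\<^esub>" "\<alpha> [^]\<^bsub>AutoGroup G\<^esub> q = \<one>\<^bsub>AutoGroup G\<^esub>"
    using group.cauchy[OF AutoGroup _ q] fin by (auto simp: finite_auto)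
  obtain n where "carrier G = autocenter n G"
    using assms(2) by (auto simp: autonilpotent_def)
  then have "\<alpha> x = x" if "x \<in> carrier G" for x
    using coprime_auto_fixes_autocenter[OF \<alpha>(1,3) cop] that by blast
  then have "\<alpha> = \<one>\<^bsub>AutoGroup G\<^esub>"
    using \<alpha>(1) by (auto simp: one_AutoGroup auto_def Bij_def extensional_def fun_eq_iff)
  with \<alpha>(2) show False ..
qed

end

lemma prime_power_if_unique_prime_divisor:
  fixes n p :: nat
  assumes "prime p" "n > 0" "\<And>q. prime q \<Longrightarrow> q dvd n \<Longrightarrow> q = p"
  shows "\<exists>k. n = p ^ k"
proof -
  obtain m where m: "n = p ^ multiplicity p n * m" "\<not> p dvd m"
    using multiplicity_decompose'[of n p] assms(1,2) prime_gt_1_nat[OF assms(1)] by auto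
  have "m = 1"
  proof (rule ccontr)
    assume "m \<noteq> 1"
    then obtain q where "prime q" "q dvd m"
      using prime_factor_nat by blast
    then show False
      using assms(3)[of q] m by (metis dvd_mult)
  qed
  then show ?thesis
    using m by auto
qed

section \<open>Fixed points of \<open>p\<close>-groups\<close>

text \<open>
  The size of an orbit divides the order of the group, a power of \<open>p\<close>. Hence every orbit that
  is not a single fixed point contributes a multiple of \<open>p\<close> to the size of \<open>E\<close>.
\<close>
lemma (in group_action) card_fixed_points_mod_prime:
  assumes "prime p" and order: "order G = p ^ k" and fin: "finite E"
  shows "card {x \<in> E. \<forall>g\<in>carrier G. \<phi> g x = x} mod p = card E mod p"
proof -
  let ?F = "{x \<in> E. \<forall>g\<in>carrier G. \<phi> g x = x}"
  let ?orbs = "orbits G E \<phi>"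
  have G: "group G"
    using group_hom by (simp add: group_hom_def)
  have finO: "finite ?orbs"
    using fin by (simp add: orbits_def)
  have orbit_fixed: "orbit G \<phi> x = {x}" if "x \<in> ?F" for x
    using that monoid.one_closed[OF group.is_monoid[OF G]] unfolding orbit_def by force
  have fixed_iff: "x \<in> ?F" if x: "x \<in> E" "card (orbit G \<phi> x) = 1" for x
  proof -
    obtain z where z: "orbit G \<phi> x = {z}"
      using x(2) card_1_singletonE by blast
    moreover have "x \<in> orbit G \<phi> x"
      using orbit_refl x(1) by blast
    ultimately have "orbit G \<phi> x = {x}" by simp
    then have "\<phi> g x = x" if "g \<in> carrier G" for g
      using that by (auto simp: orbit_def)
    then show ?thesis using x(1) by simp
  qed
  have small: "{B \<in> ?orbs. card B = 1} = (\<lambda>x. {x}) ` ?F"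
  proof (intro equalityI subsetI)
    fix B assume "B \<in> {B \<in> ?orbs. card B = 1}"
    then obtain x where "x \<in> E" "B = orbit G \<phi> x" "card (orbit G \<phi> x) = 1"
      by (auto simp: orbits_def)
    then show "B \<in> (\<lambda>x. {x}) ` ?F"
      using fixed_iff orbit_fixed by blast
  next
    fix B assume "B \<in> (\<lambda>x. {x}) ` ?F"
    then obtain x where "x \<in> ?F" "B = {x}" by blast
    then show "B \<in> {B \<in> ?orbs. card B = 1}"
      using orbit_fixed[of x] by (auto simp: orbits_def)
  qed
  have large: "p dvd card B" if B: "B \<in> ?orbs" "card B \<noteq> 1" for B
  proof -
    obtain x where "x \<in> E" "B = orbit G \<phi> x"
      using B(1) by (auto simp: orbits_def)
    then have "card B dvd p ^ k"
      using orbit_stabilizer_theorem order by (metis dvd_triv_left)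
    then obtain i where "card B = p ^ i"
      using assms(1) divides_primepow_nat by blast
    then show ?thesis
      using B(2) by (cases i) auto
  qed
  have "card E = (\<Sum>B\<in>?orbs. card B)"
    using disjoint_sum[OF fin, of "\<lambda>_. 1::nat"] by simp
  also have "\<dots> = (\<Sum>B | B \<in> ?orbs \<and> card B = 1. card B) + (\<Sum>B | B \<in> ?orbs \<and> card B \<noteq> 1. card B)"
    by (subst sum.union_disjoint[symmetric]) (use finO in \<open>auto intro!: sum.cong\<close>)
  also have "(\<Sum>B | B \<in> ?orbs \<and> card B = 1. card B) = card {B \<in> ?orbs. card B = 1}"
    by simp
  also have "\<dots> = card ?F"
    unfolding small by (rule card_image) simp
  finally have "card E = card ?F + (\<Sum>B | B \<in> ?orbs \<and> card B \<noteq> 1. card B)" .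
  moreover have "p dvd (\<Sum>B | B \<in> ?orbs \<and> card B \<noteq> 1. card B)"
    by (rule dvd_sum) (use large in blast)
  ultimately show ?thesis
    by (auto elim!: dvdE)
qed

section \<open>The action on the cosets of a characteristic subgroup\<close>

context group
begin

lemma auto_image_rcoset:
  assumes "subgroup N G" "\<And>x. x \<in> N \<Longrightarrow> \<alpha> x \<in> N" "finite N"
    "\<alpha> \<in> auto G" "x \<in> carrier G"
  shows "\<alpha> ` (N #> x) = N #> \<alpha> x"
proof -
  have NG: "N \<subseteq> carrier G" using assms(1) subgroup.subset by blast
  have "inj_on \<alpha> N"
    using assms(4) NG by (auto simp: auto_def Bij_def bij_betw_def intro: inj_on_subset)
  then have "\<alpha> ` N = N"
    using assms(2,3) by (simp add: endo_inj_surj image_subsetI)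
  moreover have "\<alpha> ` (N #> x) = \<alpha> ` N #> \<alpha> x"
    using assms(4,5) NG by (force simp: r_coset_def auto_mult)
  ultimately show ?thesis by simp
qed

lemma AutoGroup_action_on_rcosets:
  assumes fin: "finite (carrier G)" and N: "subgroup N G"
    and invariant: "\<And>\<alpha> x. \<alpha> \<in> auto G \<Longrightarrow> x \<in> N \<Longrightarrow> \<alpha> x \<in> N"
  shows "group_action (AutoGroup G) (rcosets N) (\<lambda>\<alpha>. \<lambda>C\<in>rcosets N. \<alpha> ` C)"
    (is "group_action _ _ ?\<phi>")
proof -
  have finN: "finite N"
    using fin N subgroup.subset finite_subset by blast
  have NG: "N \<subseteq> carrier G" using N subgroup.subset by blast
  have image: "\<alpha> ` (N #> x) = N #> \<alpha> x" if "\<alpha> \<in> auto G" "x \<in> carrier G" for \<alpha> x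
    using auto_image_rcoset N invariant finN that by blast
  have closed: "\<alpha> ` C \<in> rcosets N" if "\<alpha> \<in> auto G" "C \<in> rcosets N" for \<alpha> C
  proof -
    obtain x where "x \<in> carrier G" "C = N #> x"
      using \<open>C \<in> rcosets N\<close> by (auto simp: RCOSETS_def)
    then show ?thesis
      using image \<open>\<alpha> \<in> auto G\<close> NG by (simp add: rcosetsI)
  qed
  have finR: "finite (rcosets N)"
    using fin by (simp add: RCOSETS_def)
  have subG: "C \<subseteq> carrier G" if "C \<in> rcosets N" for C
    using that rcosets_subset_PowG[OF N] by blast
  have Bij: "?\<phi> \<alpha> \<in> Bij (rcosets N)" if \<alpha>: "\<alpha> \<in> auto G" for \<alpha>
  proof -
    have "inj_on \<alpha> (carrier G)"
      using \<alpha> by (simp add: auto_def Bij_def bij_betw_def)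
    then have "inj_on (?\<phi> \<alpha>) (rcosets N)"
      using subG by (auto intro!: inj_onI simp: inj_on_image_eq_iff)
    moreover from this have "?\<phi> \<alpha> ` (rcosets N) = rcosets N"
      using closed[OF \<alpha>] finR by (intro endo_inj_surj) auto
    ultimately show ?thesis
      by (simp add: Bij_def bij_betw_def)
  qed
  have "?\<phi> (\<alpha> \<otimes>\<^bsub>AutoGroup G\<^esub> \<beta>) = compose (rcosets N) (?\<phi> \<alpha>) (?\<phi> \<beta>)"
    if "\<alpha> \<in> auto G" "\<beta> \<in> auto G" for \<alpha> \<beta>
  proof
    fix C
    have "(\<alpha> \<otimes>\<^bsub>AutoGroup G\<^esub> \<beta>) ` C = \<alpha> ` \<beta> ` C" if "C \<in> rcosets N"
      using subG[OF that] mult_AutoGroup_apply[OF \<open>\<alpha> \<in> auto G\<close> \<open>\<beta> \<in> auto G\<close>]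
      by (force simp: image_image intro!: image_cong)
    then show "?\<phi> (\<alpha> \<otimes>\<^bsub>AutoGroup G\<^esub> \<beta>) C = compose (rcosets N) (?\<phi> \<alpha>) (?\<phi> \<beta>) C"
      using closed that by (simp add: compose_def)
  qed
  then have "?\<phi> \<in> hom (AutoGroup G) (BijGroup (rcosets N))"
    using Bij by (auto simp: hom_def BijGroup_def)
  then show ?thesis
    by (simp add: group_action_def group_hom_def group_hom_axioms_def AutoGroup group_BijGroup)
qed

text \<open>
  The number of fixed cosets is a multiple of \<open>p\<close>, and it is positive because \<open>N\<close> itself is
  fixed; so some other coset \<open>N x\<close> is fixed. This gives \<open>(\<alpha> x) x\<^sup>-\<^sup>1 \<in> N\<close>, and conjugation by
  \<open>x\<close> turns it into \<open>[x,\<alpha>] \<in> N\<close> because \<open>N\<close> is normal.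
\<close>
lemma exists_auto_fixed_coset:
  assumes p: "prime p" and G: "order G = p ^ k" and A: "order (AutoGroup G) = p ^ l"
    and N: "subgroup N G" and invariant: "\<And>\<alpha> x. \<alpha> \<in> auto G \<Longrightarrow> x \<in> N \<Longrightarrow> \<alpha> x \<in> N"
    and "N \<noteq> carrier G"
  obtains x where "x \<in> carrier G" "x \<notin> N" "\<And>\<alpha>. \<alpha> \<in> auto G \<Longrightarrow> autocomm G x \<alpha> \<in> N"
proof -
  have "order G > 0"
    using G p by (simp add: prime_gt_0_nat)
  then have fin: "finite (carrier G)"
    by (simp add: order_gt_0_iff_finite)
  interpret N: normal N G
    by (rule characteristic_subgroup_normal[OF N], rule invariant)
  let ?\<phi> = "\<lambda>\<alpha>. \<lambda>C\<in>rcosets N. \<alpha> ` C"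
  interpret act: group_action "AutoGroup G" "rcosets N" ?\<phi>
    by (rule AutoGroup_action_on_rcosets[OF fin N], rule invariant)
  have NG: "N \<subseteq> carrier G" using N subgroup.subset by blast
  have finN: "finite N" using NG fin finite_subset by blast
  have finR: "finite (rcosets N)"
    using fin by (simp add: RCOSETS_def)
  have image: "\<alpha> ` (N #> x) = N #> \<alpha> x" if "\<alpha> \<in> auto G" "x \<in> carrier G" for \<alpha> x
    using auto_image_rcoset N invariant finN that by blast
  define F where "F = {C \<in> rcosets N. \<forall>\<alpha>\<in>auto G. ?\<phi> \<alpha> C = C}"
  have lag: "card (rcosets N) * card N = p ^ k"
    using lagrange[OF N] G by simp
  have "card N < order G"
    using \<open>N \<noteq> carrier G\<close> NG fin by (simp add: order_def psubset_card_mono)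
  then have "card (rcosets N) \<noteq> 1"
    using lag G by auto
  moreover have "card (rcosets N) dvd p ^ k"
    using lag by (metis dvd_triv_left)
  then obtain i where i: "card (rcosets N) = p ^ i"
    using p divides_primepow_nat by blast
  ultimately have "p dvd card (rcosets N)"
    by (cases i) auto
  then have "p dvd card F"
    using act.card_fixed_points_mod_prime[OF p A finR] by (simp add: F_def mod_eq_0_iff_dvd)
  have "N = N #> \<one>"
    using NG by simp
  then have NR: "N \<in> rcosets N"
    using NG rcosetsI one_closed by metis
  have "\<alpha> ` N = N" if "\<alpha> \<in> auto G" for \<alpha>
    using image[OF that one_closed] auto_one[OF that] NG by simp
  then have "N \<in> F"
    using NR by (simp add: F_def)
  have "finite F"
    using finR by (simp add: F_def)
  then have "card F > 1"
    using \<open>p dvd card F\<close> \<open>N \<in> F\<close> p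
    by (metis card_gt_0_iff dvd_imp_le empty_iff less_le_trans prime_gt_1_nat)
  then have "F \<noteq> {N}" by auto
  then obtain C where C: "C \<in> F" "C \<noteq> N"
    using \<open>N \<in> F\<close> by blast
  then obtain x where x: "x \<in> carrier G" "C = N #> x"
    by (auto simp: F_def RCOSETS_def)
  have "x \<notin> N"
    using x C(2) N coset_join2 by blast
  moreover have "autocomm G x \<alpha> \<in> N" if \<alpha>: "\<alpha> \<in> auto G" for \<alpha>
  proof -
    have "C \<in> rcosets N" "?\<phi> \<alpha> C = C"
      using C(1) \<alpha> unfolding F_def by blast+
    then have "\<alpha> ` C = C" by simp
    then have "N #> \<alpha> x = N #> x"
      using image \<alpha> x by simp
    then have "\<alpha> x \<in> N #> x"
      using rcos_self[OF _ N] \<alpha> x(1) by (metis auto_closed)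
    then have "\<alpha> x \<otimes> inv x \<in> N"
      using N.rcos_module_imp is_group x(1) by blast
    then have "inv x \<otimes> (\<alpha> x \<otimes> inv x) \<otimes> x \<in> N"
      using N.inv_op_closed1 x(1) by blast
    then show ?thesis
      using x(1) \<alpha> by (simp add: autocomm_def m_assoc)
  qed
  ultimately show ?thesis
    using that x(1) by blast
qed

text \<open>
  If no \<open>L\<^sub>n\<close> were all of \<open>G\<close>, the series would increase strictly forever, so \<open>L\<^sub>n\<close> would have
  at least \<open>n\<close> elements for every \<open>n\<close>.
\<close>
lemma autonilpotent_if_p_groups:
  assumes p: "prime p" and G: "order G = p ^ k" and A: "order (AutoGroup G) = p ^ l"
  shows "autonilpotent G"
proof (rule ccontr)
  assume "\<not> autonilpotent G"
  then have proper: "autocenter n G \<noteq> carrier G" for n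
    by (auto simp: autonilpotent_def)
  have "order G > 0"
    using G p by (simp add: prime_gt_0_nat)
  then have fin: "finite (carrier G)"
    by (simp add: order_gt_0_iff_finite)
  have fin_n: "finite (autocenter n G)" for n
    using fin by (simp add: autocenter_def)
  have strict: "autocenter n G \<subset> autocenter (Suc n) G" for n
  proof -
    obtain x where "x \<in> carrier G" "x \<notin> autocenter n G"
      "\<And>\<alpha>. \<alpha> \<in> auto G \<Longrightarrow> autocomm G x \<alpha> \<in> autocenter n G"
      using exists_auto_fixed_coset[OF p G A _ _ proper] autocenter_characteristic_subgroup
      by metis
    then have "x \<in> autocenter (Suc n) G - autocenter n G"
      by (simp add: autocenter_Suc)
    then show ?thesis
      using autocenter_mono_Suc by blast
  qed
  have "n \<le> card (autocenter n G)" for n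
  proof (induction n)
    case (Suc n)
    then show ?case
      using psubset_card_mono[OF fin_n strict, of n] by simp
  qed simp
  moreover have "card (autocenter n G) \<le> order G" for n
    using fin by (auto simp: order_def autocenter_def intro!: card_mono)
  ultimately show False
    by (meson le_trans not_less_eq_eq order_refl)
qed

end

section \<open>Autonilpotent \<open>p\<close>-groups\<close>

theorem corollary1p1:
  fixes p :: nat and G :: "('a, 'b) monoid_scheme"
  assumes "prime p" and "finite_p_group p G"
  shows "autonilpotent G \<longleftrightarrow> finite_p_group p (AutoGroup G)"
proof -
  obtain k where "group G" and k: "order G = p ^ k"
    using assms(2) by (auto simp: finite_p_group_def)
  interpret group G by fact
  have "order G > 0"
    using k assms(1) by (simp add: prime_gt_0_nat)
  then have fin: "finite (carrier G)"
    by (simp add: order_gt_0_iff_finite)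
  show ?thesis
  proof
    assume nilp: "autonilpotent G"
    have "q = p" if q: "prime q" "q dvd order (AutoGroup G)" for q
    proof -
      have "q dvd p ^ k"
        using prime_dvd_order_AutoGroup[OF fin nilp q] k by simp
      then show ?thesis
        using q(1) assms(1) prime_dvd_power primes_dvd_imp_eq by blast
    qed
    moreover have "order (AutoGroup G) > 0"
      using finite_auto[OF fin] monoid.order_gt_0_iff_finite[OF group.is_monoid[OF AutoGroup]] by simp
    ultimately show "finite_p_group p (AutoGroup G)"
      using prime_power_if_unique_prime_divisor[OF assms(1)] AutoGroup
      by (simp add: finite_p_group_def)
  next
    assume "finite_p_group p (AutoGroup G)"
    then show "autonilpotent G"
      using autonilpotent_if_p_groups[OF assms(1) k] by (auto simp: finite_p_group_def)
  qed
qed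

end
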